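(* Let $G=(V,E)$ be a finite strongly connected simple digraph with vertex set $V=\{v_1,\dots,v_n\}$. Let the distance matrix $D=(d(v_i,v_j))_{1\le i,j\le n}$ of $G$ be expressed as $$D=\begin{pmatrix}0 & r_{n-1}^T\\ c_{n-1} & D_{n-1}\end{pmatrix},$$ where $r_{n-1}=(d(v_1,v_j))_{2\le j\le n}\in\mathbb R^{n-1}$, $c_{n-1}=(d(v_i,v_1))_{2\le i\le n}\in\mathbb R^{n-1}$ and $D_{n-1}\in\mathbb R^{(n-1)\times(n-1)}$. Suppose that $r_{n-1}^TD_{n-1}^{-1}c_{n-1}\neq 0$ and $\det(D)\det(D_{n-1})<0$ (so that $D$ and $D_{n-1}$ are invertible). Then: 1. $\mu^{\mathrm{out}}(v_1)<0$ if and only if $r_{n-1}^TD_{n-1}^{-1}\mathbf 1_{n-1}<1$; 2. $\mu^{\mathrm{in}}(v_1)<0$ if and only if $c_{n-1}^T(D_{n-1}^T)^{-1}\mathbf 1_{n-1}<1$.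
   Context: A digraph is simple if it has no multiple arcs and no loops (opposite arcs $(u,v)$ and $(v,u)$ may both be present); it is strongly connected if every vertex is reachable from every other by a directed path; $d(v,w)$ is the length of a shortest directed path from $v$ to $w$. $\mathbf 1_k$ denotes the all-ones column vector in $\mathbb R^k$. Out-curvature $\mu^{\mathrm{out}}:V\to\mathbb R$ and in-curvature $\mu^{\mathrm{in}}:V\to\mathbb R$ (Steinerberger curvatures of the digraph), viewed as vectors in $\mathbb R^n$: when $D$ is invertible (as is the case here), $\mu^{\mathrm{out}}$ is the unique solution of $DK=n\mathbf 1_n$, i.e. $\sum_{w\in V}d(v,w)\mu^{\mathrm{out}}(w)=n$ for all $v$, and $\mu^{\mathrm{in}}$ is the unique solution of $D^TK=n\mathbf 1_n$, i.e. $\sum_{w\in V}d(w,v)\mu^{\mathrm{in}}(w)=n$ for all $v$. *)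

theory Defs
  imports
    "Graph_Theory.Digraph_Component"
    "Jordan_Normal_Form.Determinant"
    "Jordan_Normal_Form.Gauss_Jordan_Elimination"
    "HOL-Library.FuncSet"
begin

text \<open>
  The \<open>LEAST\<close> is taken over a nonempty set whenever \<open>w\<close> is reachable from \<open>v\<close>; on a
  strongly connected digraph the distance is therefore meaningful for all pairs of vertices.
\<close>
definition digraph_dist :: "('a, 'b) pre_digraph \<Rightarrow> 'a \<Rightarrow> 'a \<Rightarrow> nat" where
  "digraph_dist G v w = (LEAST k. \<exists>p. pre_digraph.apath G v p w \<and> length p = k)"

text \<open>
  Steinerberger curvatures as solutions of \<open>D K = n 1\<close> and \<open>D\<^sup>T K = n 1\<close>, written without
  an enumeration of the vertices. They are functions on the vertex set (extensional outside it,
  so that a solution that is unique on the vertices is unique as a function). The definite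
  description is meaningful only when the distance matrix is invertible; the convention for
  singular distance matrices is not covered.
\<close>
definition out_curvature :: "('a, 'b) pre_digraph \<Rightarrow> 'a \<Rightarrow> real" where
  "out_curvature G = (THE K. K \<in> extensional (verts G) \<and>
     (\<forall>v\<in>verts G. (\<Sum>w\<in>verts G. real (digraph_dist G v w) * K w) = real (card (verts G))))"

definition in_curvature :: "('a, 'b) pre_digraph \<Rightarrow> 'a \<Rightarrow> real" where
  "in_curvature G = (THE K. K \<in> extensional (verts G) \<and>
     (\<forall>v\<in>verts G. (\<Sum>w\<in>verts G. real (digraph_dist G w v) * K w) = real (card (verts G))))"

text \<open>Matrix indices start at 0, vertex indices at 1.\<close>
definition distance_matrix :: "('a, 'b) pre_digraph \<Rightarrow> (nat \<Rightarrow> 'a) \<Rightarrow> nat \<Rightarrow> real mat" where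
  "distance_matrix G v n = mat n n (\<lambda>(i, j). real (digraph_dist G (v (i + 1)) (v (j + 1))))"

abbreviation ones_vec :: "nat \<Rightarrow> real vec" where
  "ones_vec k \<equiv> vec k (\<lambda>_. 1)"

text \<open>The inverse of an invertible square matrix; unspecified for singular matrices.\<close>
abbreviation inv_mat :: "real mat \<Rightarrow> real mat" where
  "inv_mat A \<equiv> the (mat_inverse A)"

end

theory Submission
  imports Defs
begin

text \<open>
  Write \<open>A\<close> for the lower right block of the distance matrix \<open>D\<close>, and let
  \<open>s = r \<bullet> (A\<^sup>-\<^sup>1 c)\<close>. Two elementary computations with the block form of \<open>D\<close> carry the proof.

  The Schur complement of \<open>A\<close> in \<open>D\<close> is the number \<open>-s\<close>, because the corner entry of \<open>D\<close>
  vanishes; hence \<open>det D = -s det A\<close> (lemma \<open>det_bordered_mat\<close>), and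
  \<open>det D det A = -s (det A)\<^sup>2 < 0\<close> says exactly that \<open>s > 0\<close>.

  Eliminating all unknowns but the first, \<open>x\<^sub>0\<close>, from \<open>D x = b 1\<close> leaves the single equation
  \<open>s x\<^sub>0 = b (r \<bullet> (A\<^sup>-\<^sup>1 1) - 1)\<close> (lemma \<open>bordered_system_first_entry\<close>). As \<open>s\<close> and \<open>b = n\<close>
  are positive, \<open>x\<^sub>0 < 0\<close> holds if and only if \<open>r \<bullet> (A\<^sup>-\<^sup>1 1) < 1\<close>.

  Since \<open>D\<close> is invertible, the curvature is the solution of this system, up to the enumeration
  of the vertices (lemmas \<open>ex1_kernel_equation\<close> and \<open>kernel_solution_neg_iff\<close>). These lemmas speak
  of a real-valued kernel \<open>d\<close> on a finite set in place of the distance, so that one proof serves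
  both parts: the in-curvature comes from the transposed kernel, and
  transposing \<open>D\<close> exchanges \<open>r\<close> with \<open>c\<close>, replaces \<open>A\<close> by its transpose and
  preserves both determinants.
\<close>

abbreviation bordered_mat :: "real vec \<Rightarrow> real vec \<Rightarrow> real mat \<Rightarrow> real mat" where
  "bordered_mat r c A \<equiv> four_block_mat (0\<^sub>m 1 1) (mat_of_row r) (mat_of_cols (dim_vec c) [c]) A"

lemma inv_mat_inverse:
  assumes A: "A \<in> carrier_mat m m" and "det A \<noteq> 0"
  shows "inv_mat A \<in> carrier_mat m m" "A * inv_mat A = 1\<^sub>m m" "inv_mat A * A = 1\<^sub>m m"
proof -
  have "mat_inverse A \<noteq> None"
    using mat_inverse(1)[OF A, of "()"] det_non_zero_imp_unit[OF A \<open>det A \<noteq> 0\<close>, of "()"] by blast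
  then obtain B where "mat_inverse A = Some B" by blast
  with mat_inverse(2)[OF A this]
  show "inv_mat A \<in> carrier_mat m m" "A * inv_mat A = 1\<^sub>m m" "inv_mat A * A = 1\<^sub>m m"
    by auto
qed

lemma transpose_bordered_mat:
  assumes "r \<in> carrier_vec m" "c \<in> carrier_vec m" "A \<in> carrier_mat m m"
  shows "transpose_mat (bordered_mat r c A) = bordered_mat c r (transpose_mat A)"
  by (rule eq_matI) (use assms in \<open>auto simp: mat_of_cols_def mat_of_row_def\<close>)

text \<open>
  Column elimination: \<open>bordered_mat r c A\<close> is the product of the block upper triangular matrix
  with diagonal blocks \<open>-s\<close> and \<open>A\<close> and a block lower unitriangular one.
\<close>
lemma det_bordered_mat:
  assumes r: "r \<in> carrier_vec m" and c: "c \<in> carrier_vec m" and A: "A \<in> carrier_mat m m"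
    and "det A \<noteq> 0"
  shows "det (bordered_mat r c A) = - (r \<bullet> (inv_mat A *\<^sub>v c)) * det A"
proof -
  note B = inv_mat_inverse[OF A \<open>det A \<noteq> 0\<close>]
  define s where "s = r \<bullet> (inv_mat A *\<^sub>v c)"
  define y where "y = inv_mat A *\<^sub>v c"
  define S where "S = mat 1 1 (\<lambda>_. - s)"
  define L where "L = mat_of_cols m [y]"
  have y: "y \<in> carrier_vec m" using B c by (simp add: y_def)
  have Ay: "A *\<^sub>v y = c"
    unfolding y_def using assoc_mult_mat_vec[OF A B(1) c] B(2) c by simp
  have S: "S \<in> carrier_mat 1 1" and L: "L \<in> carrier_mat m 1"
    and R: "mat_of_row r \<in> carrier_mat 1 m"
    using r by (auto simp: S_def L_def)
  have corner: "S * 1\<^sub>m 1 + mat_of_row r * L = 0\<^sub>m 1 1"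
    by (rule eq_matI) (use r y in \<open>auto simp: S_def L_def s_def y_def\<close>)
  have column: "0\<^sub>m m 1 * 1\<^sub>m 1 + A * L = mat_of_cols (dim_vec c) [c]"
  proof (rule eq_matI)
    fix i j assume "i < dim_row (mat_of_cols (dim_vec c) [c])"
      "j < dim_col (mat_of_cols (dim_vec c) [c])"
    hence ij: "i < m" "j = 0" using c by auto
    have "row A i \<bullet> y = c $ i" using arg_cong[OF Ay, of "\<lambda>x. x $ i"] A ij by simp
    thus "(0\<^sub>m m 1 * 1\<^sub>m 1 + A * L) $$ (i, j) = mat_of_cols (dim_vec c) [c] $$ (i, j)"
      using ij A c y by (simp add: L_def mat_of_cols_index)
  qed (use A c L in auto)
  have "bordered_mat r c A
      = four_block_mat S (mat_of_row r) (0\<^sub>m m 1) A * four_block_mat (1\<^sub>m 1) (0\<^sub>m 1 m) L (1\<^sub>m m)"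
    using corner column
    by (subst mult_four_block_mat[OF S R _ A _ _ L]) (use S R A in auto)
  also have "det \<dots> = det (four_block_mat S (mat_of_row r) (0\<^sub>m m 1) A)
      * det (four_block_mat (1\<^sub>m 1) (0\<^sub>m 1 m) L (1\<^sub>m m))"
    by (rule det_mult[of _ "1 + m"]) (use S A in auto)
  also have "det (four_block_mat S (mat_of_row r) (0\<^sub>m m 1) A) = det S * det A"
    by (rule det_four_block_mat_lower_left_zero[OF S R refl A])
  also have "det (four_block_mat (1\<^sub>m 1) (0\<^sub>m 1 m) L (1\<^sub>m m)) = 1"
    by (subst det_four_block_mat_upper_right_zero[OF _ refl L]) auto
  also have "det S = - s"
    using S by (subst det_single) (auto simp: S_def)
  finally show ?thesis by (simp add: s_def)
qed

text \<open>
  The lower rows of the system give \<open>y = b A\<^sup>-\<^sup>1 1 - x\<^sub>0 A\<^sup>-\<^sup>1 c\<close> for the remaining entries \<open>y\<close>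
  of \<open>x\<close>; the top row is \<open>r \<bullet> y = b\<close>.
\<close>
lemma bordered_system_first_entry:
  assumes r: "r \<in> carrier_vec m" and c: "c \<in> carrier_vec m" and A: "A \<in> carrier_mat m m"
    and "det A \<noteq> 0"
    and x: "x \<in> carrier_vec (1 + m)"
    and eq: "bordered_mat r c A *\<^sub>v x = b \<cdot>\<^sub>v ones_vec (1 + m)"
  shows "(r \<bullet> (inv_mat A *\<^sub>v c)) * x $ 0 = b * (r \<bullet> (inv_mat A *\<^sub>v ones_vec m) - 1)"
proof -
  note B = inv_mat_inverse[OF A \<open>det A \<noteq> 0\<close>]
  define y where "y = vec_last x m"
  define a where "a = vec_first x 1"
  have y: "y \<in> carrier_vec m" and a: "a \<in> carrier_vec 1" by (auto simp: y_def a_def)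
  have a0: "a $ 0 = x $ 0" by (simp add: a_def vec_first_def)
  have C: "mat_of_cols (dim_vec c) [c] \<in> carrier_mat m 1" and R: "mat_of_row r \<in> carrier_mat 1 m"
    using c r by auto
  have "b \<cdot>\<^sub>v ones_vec (1 + m) = bordered_mat r c A *\<^sub>v (a @\<^sub>v y)"
    using eq vec_first_last_append[OF x] by (simp add: a_def y_def)
  also have "\<dots> = (0\<^sub>m 1 1 *\<^sub>v a + mat_of_row r *\<^sub>v y)
      @\<^sub>v (mat_of_cols (dim_vec c) [c] *\<^sub>v a + A *\<^sub>v y)"
    by (rule four_block_mat_mult_vec[OF _ R C A a y]) simp
  finally have entries: "(b \<cdot>\<^sub>v ones_vec (1 + m)) $ i = ((0\<^sub>m 1 1 *\<^sub>v a + mat_of_row r *\<^sub>v y)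
      @\<^sub>v (mat_of_cols (dim_vec c) [c] *\<^sub>v a + A *\<^sub>v y)) $ i" for i by simp
  have top: "r \<bullet> y = b"
    using entries[of 0] a A by (simp add: scalar_prod_def[of "vec _ _"] scalar_prod_def[of "row _ _"])
  have Ay: "A *\<^sub>v y = b \<cdot>\<^sub>v ones_vec m - x $ 0 \<cdot>\<^sub>v c"
  proof (rule eq_vecI)
    fix i assume "i < dim_vec (b \<cdot>\<^sub>v ones_vec m - x $ 0 \<cdot>\<^sub>v c)"
    hence i: "i < m" using c by simp
    have "row (mat_of_cols (dim_vec c) [c]) i \<bullet> a = c $ i * x $ 0"
      using i c a a0 by (simp add: scalar_prod_def mat_of_cols_def)
    thus "(A *\<^sub>v y) $ i = (b \<cdot>\<^sub>v ones_vec m - x $ 0 \<cdot>\<^sub>v c) $ i"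
      using entries[of "Suc i"] i A c by (simp add: algebra_simps)
  qed (use A c in auto)
  have "y = inv_mat A *\<^sub>v (A *\<^sub>v y)"
    using assoc_mult_mat_vec[OF B(1) A y] B(3) y by simp
  also have "\<dots> = b \<cdot>\<^sub>v (inv_mat A *\<^sub>v ones_vec m) - x $ 0 \<cdot>\<^sub>v (inv_mat A *\<^sub>v c)"
    unfolding Ay
    using B(1) c by (simp add: mult_minus_distrib_mat_vec[of _ m m] mult_mat_vec[of _ m m])
  finally have y_eq: "y = b \<cdot>\<^sub>v (inv_mat A *\<^sub>v ones_vec m) - x $ 0 \<cdot>\<^sub>v (inv_mat A *\<^sub>v c)" .
  have "b = r \<bullet> (b \<cdot>\<^sub>v (inv_mat A *\<^sub>v ones_vec m) - x $ 0 \<cdot>\<^sub>v (inv_mat A *\<^sub>v c))"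
    using top y_eq by simp
  also have "\<dots> = b * (r \<bullet> (inv_mat A *\<^sub>v ones_vec m)) - x $ 0 * (r \<bullet> (inv_mat A *\<^sub>v c))"
    using r c B(1) by (subst scalar_prod_minus_distrib[of _ m]) auto
  finally show ?thesis by (simp add: algebra_simps)
qed

text \<open>
  An enumeration \<open>u\<close> of the index set turns the equations for a function \<open>K\<close> into a matrix
  equation for the vector of its values.
\<close>
lemma kernel_equation_iff_mat_vec:
  fixes d :: "'a \<Rightarrow> 'a \<Rightarrow> real"
  assumes u: "bij_betw u {0..<n} V"
  shows "(\<forall>p\<in>V. (\<Sum>q\<in>V. d p q * K q) = b) \<longleftrightarrow>
    mat n n (\<lambda>(i, j). d (u i) (u j)) *\<^sub>v vec n (\<lambda>j. K (u j)) = b \<cdot>\<^sub>v ones_vec n"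
proof -
  have "(\<forall>p\<in>V. (\<Sum>q\<in>V. d p q * K q) = b) \<longleftrightarrow>
      (\<forall>i<n. (\<Sum>q\<in>V. d (u i) q * K q) = b)"
    using bij_betw_imp_surj_on[OF u] by fastforce
  also have "\<dots> \<longleftrightarrow> (\<forall>i<n. (\<Sum>j\<in>{0..<n}. d (u i) (u j) * K (u j)) = b)"
    by (simp add: sum.reindex_bij_betw[OF u, symmetric])
  also have "\<dots> \<longleftrightarrow>
      mat n n (\<lambda>(i, j). d (u i) (u j)) *\<^sub>v vec n (\<lambda>j. K (u j)) = b \<cdot>\<^sub>v ones_vec n"
    by (auto simp: vec_eq_iff scalar_prod_def)
  finally show ?thesis .
qed

lemma ex1_kernel_equation:
  fixes d :: "'a \<Rightarrow> 'a \<Rightarrow> real"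
  assumes u: "bij_betw u {0..<n} V"
    and det: "det (mat n n (\<lambda>(i, j). d (u i) (u j))) \<noteq> 0"
  shows "\<exists>!K. K \<in> extensional V \<and> (\<forall>p\<in>V. (\<Sum>q\<in>V. d p q * K q) = b)"
proof -
  define M where "M = mat n n (\<lambda>(i, j). d (u i) (u j))"
  have M: "M \<in> carrier_mat n n" by (simp add: M_def)
  note B = inv_mat_inverse[OF M det[folded M_def]]
  define x where "x = inv_mat M *\<^sub>v (b \<cdot>\<^sub>v ones_vec n)"
  have x: "x \<in> carrier_vec n" using B(1) by (simp add: x_def)
  have Mx: "M *\<^sub>v x = b \<cdot>\<^sub>v ones_vec n"
    unfolding x_def using assoc_mult_mat_vec[OF M B(1), of "b \<cdot>\<^sub>v ones_vec n"] B(2) by simp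
  have unique: "z = x" if z: "z \<in> carrier_vec n" and "M *\<^sub>v z = b \<cdot>\<^sub>v ones_vec n" for z
    using assoc_mult_mat_vec[OF B(1) M z] that B(3) by (simp add: x_def)
  note iff = kernel_equation_iff_mat_vec[OF u, of d _ b, folded M_def]
  define K where "K = restrict (\<lambda>p. x $ inv_into {0..<n} u p) V"
  have K_u: "K (u j) = x $ j" if "j < n" for j
  proof -
    have "u j \<in> V" using bij_betwE[OF u] that by simp
    moreover have "inv_into {0..<n} u (u j) = j"
      using bij_betw_inv_into_left[OF u, of j] that by simp
    ultimately show ?thesis by (simp add: K_def)
  qed
  show ?thesis
  proof (rule ex1I[of _ K])
    have "vec n (\<lambda>j. K (u j)) = x" using x K_u by auto
    thus "K \<in> extensional V \<and> (\<forall>p\<in>V. (\<Sum>q\<in>V. d p q * K q) = b)"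
      using iff[of K] Mx by (simp add: K_def)
  next
    fix K' assume K': "K' \<in> extensional V \<and> (\<forall>p\<in>V. (\<Sum>q\<in>V. d p q * K' q) = b)"
    hence "M *\<^sub>v vec n (\<lambda>j. K' (u j)) = b \<cdot>\<^sub>v ones_vec n" using iff[of K'] by blast
    hence "vec n (\<lambda>j. K' (u j)) = x" by (intro unique) auto
    hence K'_u: "K' (u j) = x $ j" if "j < n" for j using that by auto
    show "K' = K"
    proof (rule extensionalityI[of _ V])
      fix p assume "p \<in> V"
      then obtain j where "j < n" "p = u j" using bij_betw_imp_surj_on[OF u] by auto
      thus "K' p = K p" using K_u K'_u by simp
    qed (use K' in \<open>auto simp: K_def\<close>)
  qed
qed

text \<open>
  The sign criterion for an arbitrary kernel. The determinant condition makes the coefficient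
  \<open>r \<bullet> (A\<^sup>-\<^sup>1 c)\<close> of the first unknown positive, so that dividing by it preserves signs.
\<close>
lemma kernel_solution_neg_iff:
  fixes d :: "'a \<Rightarrow> 'a \<Rightarrow> real"
  assumes u: "bij_betw u {0..<1 + m} V"
    and r: "r \<in> carrier_vec m" and c: "c \<in> carrier_vec m" and A: "A \<in> carrier_mat m m"
    and M: "mat (1 + m) (1 + m) (\<lambda>(i, j). d (u i) (u j)) = bordered_mat r c A"
    and det: "det (bordered_mat r c A) * det A < 0"
    and "b > 0"
  shows "(THE K. K \<in> extensional V \<and> (\<forall>p\<in>V. (\<Sum>q\<in>V. d p q * K q) = b)) (u 0) < 0 \<longleftrightarrow>
    r \<bullet> (inv_mat A *\<^sub>v ones_vec m) < 1" (is "?K (u 0) < 0 \<longleftrightarrow> ?t < 1")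
proof -
  have det_A: "det A \<noteq> 0" and det_M: "det (bordered_mat r c A) \<noteq> 0" using det by auto
  define s where "s = r \<bullet> (inv_mat A *\<^sub>v c)"
  have "s * (det A * det A) > 0"
    using det det_bordered_mat[OF r c A det_A] by (simp add: s_def)
  hence s: "s > 0" using zero_le_square[of "det A"] by (simp add: zero_less_mult_iff)
  have "\<forall>p\<in>V. (\<Sum>q\<in>V. d p q * ?K q) = b"
    using theI'[OF ex1_kernel_equation[OF u det_M[folded M], of b]] by blast
  hence "bordered_mat r c A *\<^sub>v vec (1 + m) (\<lambda>j. ?K (u j)) = b \<cdot>\<^sub>v ones_vec (1 + m)"
    unfolding kernel_equation_iff_mat_vec[OF u] M .
  from bordered_system_first_entry[OF r c A det_A _ this]
  have "s * ?K (u 0) = b * (?t - 1)" by (simp add: s_def)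
  moreover have "?K (u 0) < 0 \<longleftrightarrow> s * ?K (u 0) < 0"
    using s by (simp add: mult_less_0_iff)
  moreover have "b * (?t - 1) < 0 \<longleftrightarrow> ?t < 1"
    using \<open>b > 0\<close> by (simp add: mult_less_0_iff)
  ultimately show ?thesis by simp
qed

theorem proposition4p3:
  fixes G :: "('a, 'b) pre_digraph"
    and n :: nat
    and v :: "nat \<Rightarrow> 'a"
    and r c :: "real vec"
    and D D' :: "real mat"
  assumes "digraph G"
    and "strongly_connected G"
    and "bij_betw v {1..n} (verts G)"
    and "D = distance_matrix G v n"
    and "r = vec (n - 1) (\<lambda>j. real (digraph_dist G (v 1) (v (j + 2))))"
    and "c = vec (n - 1) (\<lambda>i. real (digraph_dist G (v (i + 2)) (v 1)))"
    and "D' \<in> carrier_mat (n - 1) (n - 1)"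
    and "D = four_block_mat (0\<^sub>m 1 1) (mat_of_row r) (mat_of_cols (n - 1) [c]) D'"
    and "r \<bullet> (inv_mat D' *\<^sub>v c) \<noteq> 0"
    and "det D * det D' < 0"
  shows "(out_curvature G (v 1) < 0 \<longleftrightarrow> r \<bullet> (inv_mat D' *\<^sub>v ones_vec (n - 1)) < 1) \<and>
    (in_curvature G (v 1) < 0 \<longleftrightarrow> c \<bullet> (inv_mat (transpose_mat D') *\<^sub>v ones_vec (n - 1)) < 1)"
proof -
  define m where "m = n - 1"
  define u where "u = (\<lambda>i. v (i + 1))"
  note A = assms(7)[folded m_def]
  have r: "r \<in> carrier_vec m" and c: "c \<in> carrier_vec m"
    using assms(5,6) by (simp_all add: m_def)
  have D: "D = bordered_mat r c D'" using assms(8) c by (simp add: m_def)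
  \<comment> \<open>The block form has at least one row, which excludes \<open>n = 0\<close>.\<close>
  have "dim_row D = n" using assms(4) by (simp add: distance_matrix_def)
  moreover have "dim_row D = 1 + m" using D A by simp
  ultimately have n: "n = 1 + m" by simp
  have "bij_betw (\<lambda>i. i + 1) {0..<1 + m} {1..n}"
    unfolding n by (rule bij_betw_byWitness[of _ "\<lambda>i. i - 1"]) auto
  from bij_betw_trans[OF this assms(3)] have u: "bij_betw u {0..<1 + m} (verts G)"
    by (simp add: u_def comp_def)
  have "card (verts G) = n" using bij_betw_same_card[OF u] n by simp
  hence pos: "real (card (verts G)) > 0" using n by simp
  have M: "mat (1 + m) (1 + m) (\<lambda>(i, j). real (digraph_dist G (u i) (u j))) = bordered_mat r c D'"
    using assms(4) D by (simp add: distance_matrix_def u_def n)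
  have "mat (1 + m) (1 + m) (\<lambda>(i, j). real (digraph_dist G (u j) (u i)))
      = transpose_mat (mat (1 + m) (1 + m) (\<lambda>(i, j). real (digraph_dist G (u i) (u j))))"
    by (rule eq_matI) auto
  also have "\<dots> = bordered_mat c r (transpose_mat D')"
    unfolding M by (rule transpose_bordered_mat[OF r c A])
  finally have MT: "mat (1 + m) (1 + m) (\<lambda>(i, j). real (digraph_dist G (u j) (u i)))
      = bordered_mat c r (transpose_mat D')" .
  have det: "det (bordered_mat r c D') * det D' < 0" using assms(10) D by simp
  have "det (bordered_mat c r (transpose_mat D')) = det (bordered_mat r c D')"
    unfolding transpose_bordered_mat[OF r c A, symmetric]
    by (rule det_transpose[of _ "1 + m"]) (use A in auto)
  hence detT: "det (bordered_mat c r (transpose_mat D')) * det (transpose_mat D') < 0"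
    using det det_transpose[OF A] by simp
  have "u 0 = v 1" by (simp add: u_def)
  with kernel_solution_neg_iff[OF u r c A M det pos]
    kernel_solution_neg_iff[OF u c r transpose_carrier_mat[THEN iffD2, OF A] MT detT pos]
  show ?thesis by (simp add: out_curvature_def in_curvature_def m_def)
qed

end
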